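(* Let $(X,d)$ be a metric space, $f:X\to\mathbb{R}\cup\{\pm\infty\}$ a function and $\bar x\in X$ such that $f(\bar x)=0$. If $\bar x$ is a local strict minimizer of $f$ and $f$ admits a local error bound at $\bar x$, then $f^\downarrow(\bar x)>0$.
   Context: $B(x,r)$ denotes the closed ball with center $x$ and radius $r$. The steepest descent rate of $f$ at $\bar x$ is $f^\downarrow(\bar x)=\liminf_{x\to\bar x}\frac{f(x)-f(\bar x)}{d(x,\bar x)}=\sup_{\delta>0}\inf_{x\in B(\bar x,\delta)\setminus\{\bar x\}}\frac{f(x)-f(\bar x)}{d(x,\bar x)}$ (with $\inf\varnothing=+\infty$). $\bar x$ is a local strict minimizer if $f(x)>f(\bar x)$ for all $x\ne\bar x$ in some neighbourhood of $\bar x$. Write $[f\le 0]=\{x\in X: f(x)\le 0\}$, $[r]_+=\max\{r,0\}$, and $\mathrm{dist}(x,S)=\inf_{y\in S}d(x,y)$. When $f(\bar x)=0$, $f$ admits a local error bound at $\bar x$ if there exist reals $c>0$ and $r>0$ such that $\mathrm{dist}(x,[f\le 0])\le c[f(x)]_+$ for all $x\in B(\bar x,r)$. *)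

theory Defs
  imports "HOL-Analysis.Analysis"
begin

definition steepest_descent_rate :: "('a::metric_space \<Rightarrow> ereal) \<Rightarrow> 'a \<Rightarrow> ereal" where
  "steepest_descent_rate f xbar =
     Liminf (at xbar) (\<lambda>x. (f x - f xbar) / ereal (dist x xbar))"

(* The closed-ball formula; the infimum over the empty set is \<infinity> in ereal,
   so the rate is \<infinity> at an isolated point. *)
lemma steepest_descent_rate_eq_SUP_INF:
  "steepest_descent_rate f xbar =
     (SUP \<delta>\<in>{0<..}. INF x\<in>cball xbar \<delta> - {xbar}. (f x - f xbar) / ereal (dist x xbar))"
  unfolding steepest_descent_rate_def Liminf_at
proof (rule antisym; rule SUP_least)
  fix e :: real assume "e \<in> {0<..}"
  then show "(INF x\<in>ball xbar e - {xbar}. (f x - f xbar) / ereal (dist x xbar))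
    \<le> (SUP \<delta>\<in>{0<..}. INF x\<in>cball xbar \<delta> - {xbar}. (f x - f xbar) / ereal (dist x xbar))"
    by (intro SUP_upper2[of "e / 2"] INF_superset_mono) auto
next
  fix e :: real assume "e \<in> {0<..}"
  then show "(INF x\<in>cball xbar e - {xbar}. (f x - f xbar) / ereal (dist x xbar))
    \<le> (SUP \<delta>\<in>{0<..}. INF x\<in>ball xbar \<delta> - {xbar}. (f x - f xbar) / ereal (dist x xbar))"
    by (intro SUP_upper2[of e] INF_superset_mono) auto
qed

definition local_strict_minimizer :: "('a::metric_space \<Rightarrow> ereal) \<Rightarrow> 'a \<Rightarrow> bool" where
  "local_strict_minimizer f xbar \<longleftrightarrow> (\<forall>\<^sub>F x in nhds xbar. x \<noteq> xbar \<longrightarrow> f x > f xbar)"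

(* Intended for f xbar = 0: then xbar lies in the sublevel set, so the convention
   infdist x {} = 0 plays no role. *)
definition local_error_bound :: "('a::metric_space \<Rightarrow> ereal) \<Rightarrow> 'a \<Rightarrow> bool" where
  "local_error_bound f xbar \<longleftrightarrow>
     (\<exists>c r :: real. c > 0 \<and> r > 0 \<and>
        (\<forall>x\<in>cball xbar r. ereal (infdist x {y. f y \<le> 0}) \<le> ereal c * max (f x) 0))"

end

theory Submission
  imports Defs
begin

text \<open>Near a strict minimizer \<open>xbar\<close> with \<open>f xbar = 0\<close>, the point of \<open>[f \<le> 0]\<close> closest to
  \<open>x\<close> is \<open>xbar\<close> itself, so the error bound reads \<open>dist x xbar \<le> c * f x\<close>; hence the
  difference quotients are at least \<open>1 / c\<close> near \<open>xbar\<close>.\<close>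

text \<open>Any other point of \<open>S\<close> is at least \<open>s\<close> away from
  \<open>a\<close>, hence by the triangle inequality more than \<open>s / 2\<close> away from
  \<open>x\<close>, farther than \<open>a\<close> is.\<close>

lemma infdist_isolated_point:
  fixes x a :: "'a::metric_space"
  assumes "a \<in> S" and "\<And>y. y \<in> S \<Longrightarrow> dist y a < s \<Longrightarrow> y = a" and "dist x a < s / 2"
  shows "infdist x S = dist x a"
proof (rule antisym)
  show "infdist x S \<le> dist x a"
    using assms(1) by (rule infdist_le)
  have "dist x a \<le> dist x y" if "y \<in> S" for y
  proof (cases "dist y a < s")
    case True
    then show ?thesis
      using assms(2) that by auto
  next
    case False
    then show ?thesis
      using assms(3) dist_triangle[of y a x] by (simp add: dist_commute)
  qed
  \<comment> \<open>Membership of \<open>a\<close> rules out the default value 0 of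
    \<open>infdist\<close> on the empty set.\<close>
  then show "dist x a \<le> infdist x S"
    using assms(1) by (auto simp: infdist_def intro!: cINF_greatest)
qed

theorem proposition5:
  fixes f :: "'a::metric_space \<Rightarrow> ereal" and xbar :: 'a
  assumes "f xbar = 0"
    and "local_strict_minimizer f xbar"
    and "local_error_bound f xbar"
  shows "steepest_descent_rate f xbar > 0"
proof -
  from assms(1,2) obtain s where s: "s > 0"
    and min: "\<And>x. dist x xbar < s \<Longrightarrow> x \<noteq> xbar \<Longrightarrow> f x > 0"
    unfolding local_strict_minimizer_def eventually_nhds_metric by auto
  from assms(3) obtain c r where c: "c > 0" and r: "r > 0"
    and eb: "\<And>x. x \<in> cball xbar r \<Longrightarrow> ereal (infdist x {y. f y \<le> 0}) \<le> ereal c * max (f x) 0"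
    unfolding local_error_bound_def by auto
  \<comment> \<open>The bound \<open>s / 2\<close> makes \<open>xbar\<close> the nearest point of
    the sublevel set; the bound \<open>r\<close> gives access to the error bound.\<close>
  have "ereal (1 / c) \<le> (f x - f xbar) / ereal (dist x xbar)"
    if "x \<noteq> xbar" and x: "dist x xbar < min (s / 2) r" for x
  proof -
    have pos: "f x > 0"
      using min[of x] that s by auto
    have "infdist x {y. f y \<le> 0} = dist x xbar"
    proof (rule infdist_isolated_point)
      show "y = xbar" if "y \<in> {y. f y \<le> 0}" "dist y xbar < s" for y
        using min[of y] that by (auto simp: not_less[symmetric])
    qed (use assms(1) x in auto)
    then have "ereal (dist x xbar) \<le> ereal c * f x"
      using eb[of x] x pos by (simp add: dist_commute max_def split: if_splits)
    \<comment> \<open>The value \<open>f x\<close> may be infinite; the quotient by the positive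
      real distance is then infinite as well.\<close>
    then have "ereal (1 / c) \<le> f x / ereal (dist x xbar)"
      using c \<open>x \<noteq> xbar\<close> pos by (cases "f x") (auto simp: field_simps)
    then show ?thesis
      by (simp add: assms(1))
  qed
  then have "\<forall>\<^sub>F x in at xbar. ereal (1 / c) \<le> (f x - f xbar) / ereal (dist x xbar)"
    unfolding eventually_at using s r by (intro exI[of _ "min (s / 2) r"]) auto
  then have "ereal (1 / c) \<le> steepest_descent_rate f xbar"
    unfolding steepest_descent_rate_def by (rule Liminf_bounded)
  moreover have "0 < ereal (1 / c)"
    using c by simp
  ultimately show ?thesis
    by (rule less_le_trans[rotated])
qed

end
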